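(* Let $U^0\in\mathcal X$ with $\|U^0(\mathbf x)\|_F\le\sqrt m$ for all $\mathbf x\in\overline\Omega$, and let $\kappa\ge\max\{\tfrac32 m-1,\,2\}$. Then the ETDRK2 scheme $$\widetilde U^{n+1}=e^{(\mathcal L-\kappa)\tau}U^n+\int_0^\tau e^{(\mathcal L-\kappa)(\tau-s)}\mathcal N[U^n]\,ds,$$ $$U^{n+1}=e^{(\mathcal L-\kappa)\tau}U^n+\int_0^\tau e^{(\mathcal L-\kappa)(\tau-s)}\Big(\big(1-\tfrac s\tau\big)\mathcal N[U^n]+\tfrac s\tau\,\mathcal N[\widetilde U^{n+1}]\Big)ds,\qquad n\ge0,$$ preserves the discrete maximum bound principle unconditionally: for every time step size $\tau>0$ and every $n\ge1$, $\|U^n(\mathbf x)\|_F\le\sqrt m$ for all $\mathbf x\in\overline\Omega$.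
   Context: Let $m\ge2$ be an integer, $\Omega=[-\frac12,\frac12]^m$, $\varepsilon>0$ and $\kappa>0$ constants. $\|\cdot\|_F$ is the Frobenius norm on $\mathbb R^{m\times m}$. $\mathcal X$ is the Banach space of continuous $\mathbb R^{m\times m}$-valued functions on $\overline\Omega$ satisfying the periodic boundary condition (i.e. whose periodic extension to $\mathbb R^m$ is continuous), with norm $\|W\|_{\mathcal X}=\max_{\mathbf x\in\overline\Omega}\|W(\mathbf x)\|_F$. $\mathcal L=\varepsilon^2\Delta$ with periodic boundary condition, acting entrywise; $e^{t\mathcal L}=e^{t\varepsilon^2\Delta}$ ($t\ge0$) is the periodic heat semigroup on $\mathcal X$, acting entrywise, and $e^{(\mathcal L-\kappa)t}=e^{-\kappa t}e^{t\mathcal L}$. The nonlinearity acts pointwise: $\mathcal N[U]=\kappa U+f(U)$ with $f(U)=U-UU^{\mathrm T}U$. The scheme is a time discretization of $U_t=\varepsilon^2\Delta U+f(U)$ with initial value $U^0$. *)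

theory Defs
  imports "HOL-Analysis.Analysis"
begin

section \<open>The Banach space of continuous periodic matrix fields\<close>

definition Omega :: "(real ^ 'm) set" where
  "Omega = cbox (\<chi> i. - 1/2) (\<chi> i. 1/2)"

text \<open>The library norm on \<^typ>\<open>real ^ 'm ^ 'm\<close> is the Frobenius norm.\<close>

lemma norm_matrix_frobenius:
  fixes A :: "real ^ 'n ^ 'm"
  shows "norm A = sqrt (\<Sum>i\<in>UNIV. \<Sum>j\<in>UNIV. (A $ i $ j)\<^sup>2)"
  by (simp add: norm_vec_def L2_set_def sum_nonneg)

text \<open>A continuous field on \<^term>\<open>Omega\<close> with periodic boundary condition is identified with
  its continuous 1-periodic extension to the whole space.\<close>

typedef (overloaded) 'm pfield =
  "{W :: real ^ 'm \<Rightarrow> real ^ 'm ^ ('m :: finite).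
      continuous_on UNIV W \<and> (\<forall>x i. W (x + axis i 1) = W x)}"
  morphisms field_at Abs_pfield
  by (rule exI[of _ "\<lambda>_. 0"]) auto

setup_lifting type_definition_pfield

lemma pfield_eqI: "(\<And>x. field_at V x = field_at W x) \<Longrightarrow> V = W"
  by (metis ext field_at_inject)

lemma continuous_on_field_at: "continuous_on A (field_at W)"
  using field_at[of W] continuous_on_subset by blast

lemma field_at_axis: "field_at W (x + axis i 1) = field_at W x"
  using field_at[of W] by blast

lemma field_at_nat_axis: "field_at W (x + real n *\<^sub>R axis i 1) = field_at W x"
proof (induction n)
  case (Suc n)
  have "x + real (Suc n) *\<^sub>R axis i 1 = (x + real n *\<^sub>R axis i 1) + axis i (1::real)"
    by (simp add: algebra_simps)
  then show ?case using Suc by (simp only: field_at_axis)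
qed simp

lemma field_at_int_axis: "field_at W (x + real_of_int k *\<^sub>R axis i 1) = field_at W x"
proof (cases "k \<ge> 0")
  case True
  then show ?thesis using field_at_nat_axis[of W x "nat k" i] by simp
next
  case False
  have "(x + real_of_int k *\<^sub>R axis i 1) + real (nat (- k)) *\<^sub>R axis i (1::real) = x"
    using False by (simp add: algebra_simps)
  then show ?thesis
    using field_at_nat_axis[of W "x + real_of_int k *\<^sub>R axis i 1" "nat (- k)" i]
    by (simp only:)
qed

lemma field_at_lattice:
  fixes k :: "'m :: finite \<Rightarrow> int"
  shows "field_at W (x + (\<chi> i. real_of_int (k i))) = field_at W x"
proof -
  have "field_at W (x + (\<Sum>i\<in>A. real_of_int (k i) *\<^sub>R axis i 1)) = field_at W x" if "finite A" for A
    using that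
  proof (induction A rule: finite_induct)
    case (insert a A)
    have "x + (\<Sum>i\<in>insert a A. real_of_int (k i) *\<^sub>R axis i (1::real)) =
      (x + (\<Sum>i\<in>A. real_of_int (k i) *\<^sub>R axis i 1)) + real_of_int (k a) *\<^sub>R axis a 1"
      using insert by (simp add: algebra_simps)
    then show ?case using insert by (simp only: field_at_int_axis)
  qed simp
  moreover have "(\<chi> i. real_of_int (k i)) = (\<Sum>i\<in>UNIV. real_of_int (k i) *\<^sub>R axis i (1::real))"
    by (simp add: vec_eq_iff axis_def if_distrib cong: if_cong)
  ultimately show ?thesis by simp
qed

lemma Omega_representative:
  fixes x :: "real ^ ('m :: finite)"
  obtains y where "y \<in> Omega" "\<And>W. field_at W x = field_at W y"
proof
  let ?k = "\<lambda>i. - \<lfloor>x $ i + 1/2\<rfloor>"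
  let ?y = "x + (\<chi> i. real_of_int (?k i))"
  show "?y \<in> Omega"
    unfolding Omega_def mem_box_cart by (simp; linarith)
  show "field_at W x = field_at W ?y" for W
    by (rule field_at_lattice[symmetric])
qed

lemma Omega_nonempty: "Omega \<noteq> {}"
  using Omega_representative by blast

instantiation pfield :: (finite) real_normed_vector
begin

lift_definition zero_pfield :: "'a pfield" is "\<lambda>_. 0" by simp

lift_definition plus_pfield :: "'a pfield \<Rightarrow> 'a pfield \<Rightarrow> 'a pfield" is "\<lambda>V W x. V x + W x"
  by (auto intro!: continuous_intros)

lift_definition minus_pfield :: "'a pfield \<Rightarrow> 'a pfield \<Rightarrow> 'a pfield" is "\<lambda>V W x. V x - W x"
  by (auto intro!: continuous_intros)

lift_definition uminus_pfield :: "'a pfield \<Rightarrow> 'a pfield" is "\<lambda>W x. - W x"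
  by (auto intro!: continuous_intros)

lift_definition scaleR_pfield :: "real \<Rightarrow> 'a pfield \<Rightarrow> 'a pfield" is "\<lambda>r W x. r *\<^sub>R W x"
  by (auto intro!: continuous_intros)

definition norm_pfield :: "'a pfield \<Rightarrow> real" where
  "norm_pfield W = (SUP x\<in>Omega. norm (field_at W x))"

definition dist_pfield :: "'a pfield \<Rightarrow> 'a pfield \<Rightarrow> real" where
  "dist_pfield V W = norm (V - W)"

definition sgn_pfield :: "'a pfield \<Rightarrow> 'a pfield" where
  "sgn_pfield W = inverse (norm W) *\<^sub>R W"

definition uniformity_pfield :: "('a pfield \<times> 'a pfield) filter" where
  "uniformity_pfield = (INF e\<in>{0 <..}. principal {(x, y). dist x y < e})"

definition open_pfield :: "'a pfield set \<Rightarrow> bool" where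
  "open_pfield S = (\<forall>x\<in>S. \<forall>\<^sub>F (x', y) in uniformity. x' = x \<longrightarrow> y \<in> S)"

lemma bdd_above_norm_field: "bdd_above ((\<lambda>x. norm (field_at W x)) ` Omega)"
proof -
  have "compact ((\<lambda>x. norm (field_at W x)) ` Omega)"
    by (intro compact_continuous_image continuous_on_norm continuous_on_field_at)
      (simp add: Omega_def)
  then show ?thesis by (intro bounded_imp_bdd_above compact_imp_bounded)
qed

lemma norm_field_at_le: "norm (field_at W x) \<le> norm W"
proof -
  obtain y where "y \<in> Omega" "field_at W x = field_at W y"
    using Omega_representative[of x] by metis
  then show ?thesis
    unfolding norm_pfield_def using cSUP_upper[OF _ bdd_above_norm_field] by fastforce
qed

lemma norm_pfield_leI: "(\<And>x. x \<in> Omega \<Longrightarrow> norm (field_at W x) \<le> b) \<Longrightarrow> norm W \<le> b"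
  unfolding norm_pfield_def by (intro cSUP_least Omega_nonempty)

instance
proof
  fix a b :: real and V W X :: "'a pfield"
  show "V + W + X = V + (W + X)" "V + W = W + V" "0 + W = W" "- W + W = 0"
    "V - W = V + - W"
    by (transfer; simp add: algebra_simps)+
  show "a *\<^sub>R (V + W) = a *\<^sub>R V + a *\<^sub>R W" "(a + b) *\<^sub>R W = a *\<^sub>R W + b *\<^sub>R W"
    "a *\<^sub>R b *\<^sub>R W = (a * b) *\<^sub>R W" "1 *\<^sub>R W = W"
    by (transfer; simp add: algebra_simps)+
  show "norm W = 0 \<longleftrightarrow> W = 0"
  proof
    assume "norm W = 0"
    then have "field_at W x = 0" for x using norm_field_at_le[of W x] by simp
    then show "W = 0" by (intro pfield_eqI) (simp add: zero_pfield.rep_eq)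
  next
    assume "W = 0"
    then show "norm W = 0"
      by (simp add: norm_pfield_def zero_pfield.rep_eq Omega_nonempty)
  qed
  show "norm (V + W) \<le> norm V + norm W"
    by (rule norm_pfield_leI)
      (auto simp: plus_pfield.rep_eq intro!: norm_triangle_le add_mono norm_field_at_le)
  show "norm (a *\<^sub>R W) = \<bar>a\<bar> * norm W"
  proof (rule antisym)
    show le: "norm (a *\<^sub>R W) \<le> \<bar>a\<bar> * norm W" 
      by (rule norm_pfield_leI)
        (auto simp: scaleR_pfield.rep_eq intro!: mult_left_mono norm_field_at_le)
    show "\<bar>a\<bar> * norm W \<le> norm (a *\<^sub>R W)"
    proof (cases "a = 0")
      case True
      obtain x :: "real ^ 'a" where "x \<in> Omega" using Omega_nonempty by blast
      then show ?thesis using norm_field_at_le[of "a *\<^sub>R W" x] True by simp (metis norm_ge_zero order_trans)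
    next
      case False
      have "norm W \<le> norm (a *\<^sub>R W) / \<bar>a\<bar>"
      proof (rule norm_pfield_leI)
        fix x
        show "norm (field_at W x) \<le> norm (a *\<^sub>R W) / \<bar>a\<bar>"
          using norm_field_at_le[of "a *\<^sub>R W" x] False
          by (simp add: scaleR_pfield.rep_eq field_simps)
      qed
      then show ?thesis using False by (simp add: field_simps)
    qed
  qed
qed (rule dist_pfield_def sgn_pfield_def uniformity_pfield_def open_pfield_def)+

end

instance pfield :: (finite) banach
proof
  fix X :: "nat \<Rightarrow> 'a pfield"
  assume X: "Cauchy X"
  have "uniformly_Cauchy_on UNIV (\<lambda>n. field_at (X n))"
    unfolding uniformly_Cauchy_on_def
  proof (intro allI impI)
    fix e :: real assume "e > 0"
    then obtain M where M: "\<And>m n. m \<ge> M \<Longrightarrow> n \<ge> M \<Longrightarrow> dist (X m) (X n) < e"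
      using X unfolding Cauchy_def by metis
    have "dist (field_at (X m) x) (field_at (X n) x) < e" if "m \<ge> M" "n \<ge> M" for m n x
      using M[OF that] norm_field_at_le[of "X m - X n" x]
      by (simp add: dist_norm minus_pfield.rep_eq)
    then show "\<exists>M. \<forall>x\<in>UNIV. \<forall>m\<ge>M. \<forall>n\<ge>M. dist (field_at (X m) x) (field_at (X n) x) < e"
      by blast
  qed
  then obtain l where l: "uniform_limit UNIV (\<lambda>n. field_at (X n)) l sequentially"
    using Cauchy_uniformly_convergent uniformly_convergent_on_def by metis
  have "continuous_on UNIV l"
    by (rule uniform_limit_theorem[OF _ l]) (simp_all add: continuous_on_field_at always_eventually)
  moreover have "l (x + axis i 1) = l x" for x i
  proof -
    have "(\<lambda>n. field_at (X n) x) \<longlonglongrightarrow> l x" 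
      "(\<lambda>n. field_at (X n) (x + axis i 1)) \<longlonglongrightarrow> l (x + axis i 1)"
      using tendsto_uniform_limitI[OF l] by auto
    then show ?thesis by (simp add: field_at_axis LIMSEQ_unique)
  qed
  ultimately obtain L where L: "field_at L = l"
    using Abs_pfield_inverse[of l] by auto
  have "X \<longlonglongrightarrow> L"
  proof (rule metric_LIMSEQ_I)
    fix e :: real assume "e > 0"
    then have "\<forall>\<^sub>F n in sequentially. \<forall>x\<in>UNIV. dist (field_at (X n) x) (l x) < e / 2"
      using l unfolding uniform_limit_iff by (meson half_gt_zero)
    then obtain N where N: "\<And>n x. n \<ge> N \<Longrightarrow> dist (field_at (X n) x) (l x) < e / 2"
      unfolding eventually_sequentially by auto
    have "norm (X n - L) \<le> e / 2" if "n \<ge> N" for n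
      using N[OF that]
      by (intro norm_pfield_leI) (auto simp: minus_pfield.rep_eq L dist_norm intro: less_imp_le)
    then show "\<exists>N. \<forall>n\<ge>N. dist (X n) L < e"
      using \<open>e > 0\<close> by (metis dist_norm field_sum_of_halves less_add_same_cancel1 half_gt_zero order_le_less_trans)
  qed
  then show "convergent X" by (auto simp: convergent_def)
qed


section \<open>The periodic heat semigroup\<close>

definition has_partial :: "'m::finite pfield \<Rightarrow> 'm \<Rightarrow> 'm pfield \<Rightarrow> bool" where
  "has_partial W i V \<longleftrightarrow>
    (\<forall>x. ((\<lambda>h. field_at W (x + h *\<^sub>R axis i 1)) has_vector_derivative field_at V x) (at 0))"

text \<open>The graph of \<open>\<epsilon>\<^sup>2 \<Delta>\<close> on the twice continuously differentiable
  periodic fields; derivatives of matrix-valued maps are entrywise derivatives, and periodicity and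
  continuity of the partial derivatives are part of their type.\<close>

definition diffusion_graph :: "real \<Rightarrow> ('m::finite pfield \<times> 'm pfield) set" where
  "diffusion_graph \<epsilon> =
    {(W, \<epsilon>\<^sup>2 *\<^sub>R (\<Sum>i\<in>UNIV. H i i)) | W H.
      \<exists>D. (\<forall>i. has_partial W i (D i)) \<and> (\<forall>i j. has_partial (D i) j (H i j))}"

definition C0_semigroup :: "(real \<Rightarrow> 'a::real_normed_vector \<Rightarrow> 'a) \<Rightarrow> bool" where
  "C0_semigroup S \<longleftrightarrow>
    (\<forall>t\<ge>0. bounded_linear (S t)) \<and>
    (\<forall>w. S 0 w = w) \<and>
    (\<forall>s\<ge>0. \<forall>t\<ge>0. \<forall>w. S (s + t) w = S s (S t w)) \<and>
    (\<forall>w. ((\<lambda>t. S t w) \<longlongrightarrow> w) (at_right 0))"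

text \<open>The infinitesimal generator, as a graph.\<close>

definition generator :: "(real \<Rightarrow> 'a::real_normed_vector \<Rightarrow> 'a) \<Rightarrow> ('a \<times> 'a) set" where
  "generator S = {(w, v). ((\<lambda>t. (S t w - w) /\<^sub>R t) \<longlongrightarrow> v) (at_right 0)}"

text \<open>As an operator on the Banach space of continuous periodic fields, \<open>\<epsilon>\<^sup>2 \<Delta>\<close> with
  periodic boundary condition is the closure of its restriction to twice continuously
  differentiable fields. A strongly continuous semigroup is determined by its generator, so the
  following predicate determines \<open>S t\<close> for all \<open>t \<ge> 0\<close>; values at negative times
  are irrelevant.\<close>

definition periodic_heat_semigroup ::
    "real \<Rightarrow> (real \<Rightarrow> 'm::finite pfield \<Rightarrow> 'm pfield) \<Rightarrow> bool" where
  "periodic_heat_semigroup \<epsilon> S \<longleftrightarrow> C0_semigroup S \<and> generator S = closure (diffusion_graph \<epsilon>)"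


section \<open>The ETDRK2 scheme\<close>

definition reaction :: "real ^ 'm ^ 'm \<Rightarrow> real ^ 'm ^ 'm" where
  "reaction U = U - U ** transpose U ** U"

lemma continuous_on_reaction: "continuous_on A reaction"
  unfolding reaction_def matrix_matrix_mult_def transpose_def
  by (intro continuous_intros)

lift_definition nonlinearity :: "real \<Rightarrow> 'm::finite pfield \<Rightarrow> 'm pfield" is
  "\<lambda>\<kappa> U x. \<kappa> *\<^sub>R U x + reaction (U x)"
  by (auto intro!: continuous_intros continuous_on_compose2[OF continuous_on_reaction])

definition etd_propagator ::
    "(real \<Rightarrow> 'm::finite pfield \<Rightarrow> 'm pfield) \<Rightarrow> real \<Rightarrow> real \<Rightarrow> 'm pfield \<Rightarrow> 'm pfield" where
  "etd_propagator S \<kappa> t W = exp (- \<kappa> * t) *\<^sub>R S t W"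

text \<open>The integrals below are integrals of functions of \<open>s\<close> with values in the Banach
  space of fields.\<close>

definition etdrk2_predictor ::
    "(real \<Rightarrow> 'm::finite pfield \<Rightarrow> 'm pfield) \<Rightarrow> real \<Rightarrow> real \<Rightarrow> 'm pfield \<Rightarrow> 'm pfield" where
  "etdrk2_predictor S \<kappa> \<tau> U =
    etd_propagator S \<kappa> \<tau> U +
    integral {0..\<tau>} (\<lambda>s. etd_propagator S \<kappa> (\<tau> - s) (nonlinearity \<kappa> U))"

definition etdrk2_step ::
    "(real \<Rightarrow> 'm::finite pfield \<Rightarrow> 'm pfield) \<Rightarrow> real \<Rightarrow> real \<Rightarrow> 'm pfield \<Rightarrow> 'm pfield" where
  "etdrk2_step S \<kappa> \<tau> U =
    etd_propagator S \<kappa> \<tau> U +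
    integral {0..\<tau>} (\<lambda>s. etd_propagator S \<kappa> (\<tau> - s)
      ((1 - s / \<tau>) *\<^sub>R nonlinearity \<kappa> U +
       (s / \<tau>) *\<^sub>R nonlinearity \<kappa> (etdrk2_predictor S \<kappa> \<tau> U)))"

primrec etdrk2 ::
    "(real \<Rightarrow> 'm::finite pfield \<Rightarrow> 'm pfield) \<Rightarrow> real \<Rightarrow> real \<Rightarrow> 'm pfield \<Rightarrow> nat \<Rightarrow> 'm pfield" where
  "etdrk2 S \<kappa> \<tau> U0 0 = U0"
| "etdrk2 S \<kappa> \<tau> U0 (Suc n) = etdrk2_step S \<kappa> \<tau> (etdrk2 S \<kappa> \<tau> U0 n)"

end

theory Submission
  imports Defs
begin

text \<open>
  Write \<open>m\<close> for the matrix size. One step of the scheme maps \<open>U\<close> to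
  \<open>exp(-\<kappa>\<tau>) S(\<tau>) U + \<integral> exp(-\<kappa>(\<tau> - s)) S(\<tau> - s) F(s) ds\<close>. If the heat
  semigroup \<open>S\<close> is a contraction in the maximum norm, if \<open>\<parallel>U\<parallel> \<le> r\<close> and if \<open>\<parallel>F(s)\<parallel> \<le> \<kappa> r\<close>, then
  the result has norm at most \<open>exp(-\<kappa>\<tau>) r + (1 - exp(-\<kappa>\<tau>)) r = r\<close>, whatever \<open>\<tau>\<close> is
  (\<open>etd_step_norm_le\<close>). For \<open>r = \<surd>m\<close> this is used twice per step: for the predictor, where \<open>F\<close> is
  the constant \<open>\<N>[U]\<close>, and for the corrector, where \<open>F(s)\<close> is a convex combination of \<open>\<N>[U]\<close> and
  \<open>\<N>\<close> of the predictor. Two facts remain.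

  The nonlinearity maps the ball of radius \<open>\<surd>m\<close> into the ball of radius \<open>\<kappa>\<surd>m\<close>
  (\<open>norm_shifted_reaction_le\<close>). If \<open>a\<^sub>i\<close> are the squared singular values of \<open>U\<close>, the claim is
  \<open>\<Sum> a\<^sub>i (\<kappa> + 1 - a\<^sub>i)\<^sup>2 \<le> \<kappa>\<^sup>2 m\<close> whenever \<open>\<Sum> a\<^sub>i \<le> m\<close>. The polynomial \<open>a (\<kappa> + 1 - a)\<^sup>2\<close> exceeds its
  tangent \<open>\<kappa>\<^sup>2 + \<kappa> (\<kappa> - 2) (a - 1)\<close> at \<open>a = 1\<close> by \<open>(a - 1)\<^sup>2 (a - 2 \<kappa>)\<close>, which is not positive
  because \<open>a \<le> m \<le> 2 \<kappa>\<close>; summing the tangent bound gives the claim as \<open>\<kappa> \<ge> 2\<close>. The same computation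
  is carried out with traces of matrix products.

  The heat semigroup is a contraction (\<open>heat_semigroup_contraction\<close>). The semigroup is given by its
  generator \<open>A\<close>, the closure of \<open>\<epsilon>\<^sup>2 \<Delta>\<close> on twice continuously differentiable fields, so
  contractivity is read off from \<open>A\<close>. At a maximum point of \<open>|W|\<^sup>2\<close> the second derivative test gives
  \<open>W \<bullet> \<Delta>W \<le> 0\<close>, hence \<open>\<parallel>W\<parallel> \<le> \<parallel>W - h A W\<parallel>\<close> for \<open>h > 0\<close>, and this inequality survives the closure.
  Such dissipativity makes each backward Euler step of the orbit \<open>t \<mapsto> S(t) u\<close> norm-decreasing; the
  error of \<open>n\<close> steps of length \<open>t/n\<close> tends to \<open>0\<close> for \<open>u\<close> in the domain of \<open>A\<close>, and the domain is
  dense (\<open>dissipative_generator_imp_contraction\<close>). The uniformity in this limit comes from local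
  boundedness of strongly continuous semigroups, a consequence of the Banach-Steinhaus theorem.
\<close>

section \<open>The matrix inequality\<close>


lemma norm_matrix_mult_le:
  fixes A :: "real ^ 'k ^ 'm" and B :: "real ^ 'n ^ 'k"
  shows "norm (A ** B) \<le> norm A * norm B"
proof (rule power2_le_imp_le)
  have B: "(norm B)\<^sup>2 = (\<Sum>j\<in>UNIV. (norm (column j B))\<^sup>2)"
  proof -
    have "(norm B)\<^sup>2 = (\<Sum>i\<in>UNIV. \<Sum>j\<in>UNIV. (B $ i $ j)\<^sup>2)"
      by (simp add: norm_matrix_frobenius sum_nonneg)
    also have "\<dots> = (\<Sum>j\<in>UNIV. \<Sum>i\<in>UNIV. (B $ i $ j)\<^sup>2)"
      by (rule sum.swap)
    finally show ?thesis
      by (simp add: norm_vec_def L2_set_def sum_nonneg column_def)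
  qed
  have "(norm (A ** B))\<^sup>2 = (\<Sum>i\<in>UNIV. \<Sum>j\<in>UNIV. (row i A \<bullet> column j B)\<^sup>2)"
    by (simp add: norm_matrix_frobenius sum_nonneg matrix_mult_dot inner_vec_def
        matrix_matrix_mult_def row_def column_def)
  also have "\<dots> \<le> (\<Sum>i\<in>UNIV. \<Sum>j\<in>UNIV. (norm (A $ i))\<^sup>2 * (norm (column j B))\<^sup>2)"
    by (intro sum_mono) (metis Cauchy_Schwarz_ineq power2_norm_eq_inner row_def vec_nth_inverse)
  also have "\<dots> = (norm A)\<^sup>2 * (norm B)\<^sup>2"
    by (simp add: B sum_product norm_vec_def[of A] L2_set_def sum_nonneg)
  finally show "(norm (A ** B))\<^sup>2 \<le> (norm A * norm B)\<^sup>2"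
    by (simp add: power_mult_distrib)
qed simp

lemma inner_matrix_eq_trace:
  fixes A B :: "real ^ 'n ^ 'm"
  shows "A \<bullet> B = trace (transpose A ** B)"
proof -
  have "A \<bullet> B = (\<Sum>i\<in>UNIV. \<Sum>j\<in>UNIV. A $ i $ j * B $ i $ j)"
    by (simp add: inner_vec_def)
  also have "\<dots> = (\<Sum>j\<in>UNIV. \<Sum>i\<in>UNIV. A $ i $ j * B $ i $ j)"
    by (rule sum.swap)
  finally show ?thesis
    by (simp add: trace_def matrix_matrix_mult_def transpose_def)
qed

text \<open>With \<open>R = U\<^sup>TU - 1\<close> the argument is \<open>\<kappa> U - U R\<close>. Expanding its square, the cross term
  produces \<open>\<parallel>R\<parallel>\<^sup>2\<close> and the trace of \<open>R\<close>, so that the bound holds up to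
  \<open>\<kappa> (\<kappa> - 2) (\<parallel>U\<parallel>\<^sup>2 - m) + \<parallel>U R\<parallel>\<^sup>2 - 2 \<kappa> \<parallel>R\<parallel>\<^sup>2\<close>; submultiplicativity of the Frobenius norm
  and \<open>\<parallel>U\<parallel>\<^sup>2 \<le> m \<le> 2 \<kappa>\<close> show that this is not positive.\<close>

lemma norm_shifted_reaction_le:
  fixes U :: "real ^ 'm ^ 'm"
  assumes U: "norm U \<le> sqrt (real CARD('m))"
    and \<kappa>: "\<kappa> \<ge> 2" "real CARD('m) \<le> 2 * \<kappa>"
  shows "norm (\<kappa> *\<^sub>R U + reaction U) \<le> \<kappa> * sqrt (real CARD('m))"
proof -
  define m where "m = real CARD('m)"
  define s where "s = (norm U)\<^sup>2"
  define P where "P = transpose U ** U"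
  define R where "R = P - mat 1"
  have P: "P = R + mat 1"
    by (simp add: R_def)
  have s: "0 \<le> s" "s \<le> m"
    using U by (auto simp: s_def m_def sqrt_le_D real_le_rsqrt
        intro: order_trans[OF power_mono[OF U norm_ge_zero]])
  have sym: "transpose P = P"
    by (simp add: P_def matrix_transpose_mul)
  have field: "\<kappa> *\<^sub>R U + reaction U = \<kappa> *\<^sub>R U - U ** R"
  proof -
    have "U ** transpose U ** U = U ** R + U"
      using P by (simp add: P_def matrix_mul_assoc[symmetric] matrix_add_ldistrib)
    then show ?thesis
      by (simp add: reaction_def)
  qed
  have trR: "trace R = s - m"
    using inner_matrix_eq_trace[of U U]
    by (simp add: R_def trace_sub trace_I s_def m_def P_def power2_norm_eq_inner)
  have cross: "U \<bullet> (U ** R) = (norm R)\<^sup>2 + (s - m)"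
  proof -
    have "U \<bullet> (U ** R) = trace (P ** R)"
      by (simp add: inner_matrix_eq_trace P_def matrix_mul_assoc)
    also have "\<dots> = P \<bullet> R"
      by (simp add: inner_matrix_eq_trace sym)
    also have "\<dots> = R \<bullet> R + mat 1 \<bullet> R"
      by (simp add: P inner_add_left)
    also have "mat 1 \<bullet> R = trace R"
      by (simp add: inner_matrix_eq_trace transpose_mat)
    finally show ?thesis
      by (simp add: trR power2_norm_eq_inner)
  qed
  have UR: "(norm (U ** R))\<^sup>2 \<le> s * (norm R)\<^sup>2"
    using power_mono[OF norm_matrix_mult_le[of U R] norm_ge_zero, of 2]
    by (simp add: s_def power_mult_distrib)
  have "(norm (\<kappa> *\<^sub>R U - U ** R))\<^sup>2
      = \<kappa>\<^sup>2 * s - 2 * \<kappa> * (U \<bullet> (U ** R)) + (norm (U ** R))\<^sup>2"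
    unfolding s_def power2_norm_eq_inner
    by (simp add: inner_diff_left inner_diff_right inner_commute power2_eq_square)
  also have "\<dots> \<le> \<kappa>\<^sup>2 * s - 2 * \<kappa> * ((norm R)\<^sup>2 + (s - m)) + s * (norm R)\<^sup>2"
    using UR by (simp add: cross)
  also have "\<dots> = \<kappa>\<^sup>2 * m - (\<kappa> * (\<kappa> - 2) * (m - s) + (2 * \<kappa> - s) * (norm R)\<^sup>2)"
    by (simp add: algebra_simps power2_eq_square)
  also have "\<dots> \<le> \<kappa>\<^sup>2 * m"
  proof -
    have "0 \<le> \<kappa> * (\<kappa> - 2) * (m - s)" "0 \<le> (2 * \<kappa> - s) * (norm R)\<^sup>2"
      using s \<kappa> by (simp_all add: m_def)
    then show ?thesis by linarith
  qed
  finally have "(norm (\<kappa> *\<^sub>R U - U ** R))\<^sup>2 \<le> (\<kappa> * sqrt m)\<^sup>2"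
    using s by (simp add: power_mult_distrib)
  then have "norm (\<kappa> *\<^sub>R U - U ** R) \<le> \<kappa> * sqrt m"
    by (rule power2_le_imp_le) (use \<kappa> s in simp)
  then show ?thesis
    by (simp add: field m_def)
qed

section \<open>Contractivity of semigroups with dissipative generator\<close>

text \<open>The Banach-Steinhaus theorem for sequences. The closed sets \<open>E k\<close> on which all \<open>T n\<close> are
  bounded by \<open>k\<close> cover the space, so by Baire's theorem one of them contains a ball; a vector in that
  ball differs from the centre by an arbitrary direction, which bounds all the operator norms.\<close>

lemma uniform_boundedness:
  fixes T :: "nat \<Rightarrow> 'a::banach \<Rightarrow> 'b::real_normed_vector"
  assumes T: "\<And>n. bounded_linear (T n)"
    and bdd: "\<And>w. bounded (range (\<lambda>n. T n w))"
  obtains M where "\<And>n w. norm (T n w) \<le> M * norm w"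
proof -
  define E where "E = (\<lambda>k::nat. {w. \<forall>n. norm (T n w) \<le> real k})"
  have closed: "closed (E k)" for k
    unfolding E_def
    by (intro closed_Collect_all closed_Collect_le continuous_intros
        bounded_linear.continuous_on[OF T])
  have "w \<in> (\<Union>k. E k)" for w
  proof -
    obtain B where "norm (T n w) \<le> B" for n
      using bdd[of w] by (auto simp: bounded_iff)
    moreover obtain k :: nat where "B \<le> real k"
      using real_arch_simple by blast
    ultimately show ?thesis
      by (auto simp: E_def intro: order_trans)
  qed
  then have "(\<Union>k. E k) = UNIV" by blast
  then have "interior (\<Union>(range E)) \<noteq> {}" by simp
  then obtain k where "interior (E k) \<noteq> {}"
    using Met_TC.metric_Baire_category_alt[of "range E"] closed complete_UNIV
    by auto
  then obtain w0 e where e: "e > 0" "cball w0 e \<subseteq> E k"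
    by (meson ex_in_conv mem_interior_cball)
  have "norm (T n w) \<le> (2 * real k / e) * norm w" for n w
  proof (cases "w = 0")
    case False
    interpret bounded_linear "T n" by (rule T)
    define z where "z = (e / norm w) *\<^sub>R w"
    have "w0 + z \<in> E k" "w0 \<in> E k"
      using e False by (auto simp: z_def dist_norm intro!: subsetD[OF e(2)])
    then have "norm (T n z) \<le> real k + real k"
      using norm_triangle_ineq4[of "T n (w0 + z)" "T n w0"]
      unfolding E_def by (smt (verit) add_diff_cancel_left' add mem_Collect_eq)
    moreover have "norm (T n z) = e / norm w * norm (T n w)"
      using e by (simp add: z_def scaleR)
    ultimately show ?thesis
      using e False by (simp add: field_simps)
  qed (simp add: linear_simps(3)[OF T])
  then show thesis by (rule that)
qed

text \<open>Otherwise there are times \<open>t\<^sub>n \<rightarrow> 0\<close> at which the operator norms are unbounded, although each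
  \<open>S(t\<^sub>n) v\<close> converges to \<open>v\<close>: this contradicts uniform boundedness.\<close>

lemma C0_semigroup_locally_bounded:
  fixes S :: "real \<Rightarrow> 'a::banach \<Rightarrow> 'a"
  assumes S: "C0_semigroup S"
  obtains \<delta> M where "\<delta> > 0" "M > 0" "\<And>t w. 0 \<le> t \<Longrightarrow> t \<le> \<delta> \<Longrightarrow> norm (S t w) \<le> M * norm w"
proof -
  have "\<exists>n::nat. \<forall>t w. 0 \<le> t \<and> t \<le> 1 / (real n + 1) \<longrightarrow> norm (S t w) \<le> real n * norm w"
  proof (rule ccontr)
    assume "\<not> ?thesis"
    then have "\<forall>n. \<exists>t w. 0 \<le> t \<and> t \<le> 1 / (real n + 1) \<and> norm (S t w) > real n * norm w"
      by (auto simp: not_le)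
    then obtain t w where t: "\<And>n. 0 \<le> t n" "\<And>n. t n \<le> 1 / (real n + 1)"
      and w: "\<And>n::nat. norm (S (t n) (w n)) > real n * norm (w n)"
      by metis
    have t0: "t \<longlonglongrightarrow> 0"
    proof (rule tendsto_sandwich[OF always_eventually always_eventually tendsto_const])
      show "(\<lambda>n. 1 / (real n + 1)) \<longlonglongrightarrow> 0"
        using LIMSEQ_inverse_real_of_nat by (simp add: inverse_eq_divide add.commute)
    qed (use t in auto)
    have "bounded (range (\<lambda>n. S (t n) v))" for v
    proof -
      have "((\<lambda>t. S t v) \<longlongrightarrow> S 0 v) (at 0 within {0..})"
        using S unfolding C0_semigroup_def at_within_Ici_at_right by auto
      then have "((\<lambda>t. S t v) \<circ> t) \<longlonglongrightarrow> S 0 v"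
        using t(1) t0 continuous_within[of 0 "{0..}" "\<lambda>t. S t v"]
          continuous_within_sequentially[of 0 "{0..}" "\<lambda>t. S t v"] by auto
      then show ?thesis
        using convergent_imp_bounded unfolding comp_def by auto
    qed
    then obtain M where M: "\<And>n v. norm (S (t n) v) \<le> M * norm v"
      using uniform_boundedness[of "\<lambda>n. S (t n)"] S t unfolding C0_semigroup_def by metis
    obtain n :: nat where "M \<le> real n"
      using real_arch_simple by blast
    then show False
      using w[of n] M[of n "w n"] mult_right_mono[of M "real n" "norm (w n)"] by simp
  qed
  then obtain n :: nat where n: "\<And>t w. 0 \<le> t \<Longrightarrow> t \<le> 1 / (real n + 1) \<Longrightarrow> norm (S t w) \<le> real n * norm w"
    by blast
  show thesis
  proof
    show "1 / (real n + 1) > 0" "real n + 1 > 0" by auto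
    show "norm (S t w) \<le> (real n + 1) * norm w" if "0 \<le> t" "t \<le> 1 / (real n + 1)" for t w
      using n[OF that, of w] norm_ge_zero[of w] by (simp add: algebra_simps add_increasing)
  qed
qed

text \<open>Strong continuity is postulated at time \<open>0\<close> from the right. Continuity from the left at later
  times is where local boundedness enters: \<open>S(t) w - S(s) w = S(s) (S(t - s) w - w)\<close>, with \<open>s\<close>
  varying.\<close>

lemma C0_semigroup_orbit_continuous:
  fixes S :: "real \<Rightarrow> 'a::real_normed_vector \<Rightarrow> 'a"
  assumes S: "C0_semigroup S"
    and M: "M > 0" "\<And>t w. 0 \<le> t \<Longrightarrow> t \<le> \<delta> \<Longrightarrow> norm (S t w) \<le> M * norm w"
  shows "continuous_on {0..\<delta>} (\<lambda>t. S t w)"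
  unfolding continuous_on_iff
proof (intro ballI allI impI)
  fix x e :: real assume x: "x \<in> {0..\<delta>}" and e: "0 < e"
  have "((\<lambda>t. S t w) \<longlongrightarrow> w) (at_right 0)" and S0: "S 0 w = w"
    using S unfolding C0_semigroup_def by auto
  then obtain d where d: "d > 0" "\<And>t. 0 < t \<Longrightarrow> t < d \<Longrightarrow> norm (S t w - w) < e / M"
    using e M(1) unfolding tendsto_iff eventually_at_right_field dist_norm
    by (metis divide_pos_pos)
  have close: "norm (S t w - S s w) < e" if "s \<in> {0..\<delta>}" "t \<in> {0..\<delta>}" "s \<le> t" "t - s < d" for s t
  proof -
    have "S t w - S s w = S s (S (t - s) w - w)"
    proof -
      have "bounded_linear (S s)"
        using S that unfolding C0_semigroup_def by auto
      moreover have "S (s + (t - s)) w = S s (S (t - s) w)"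
        using S that unfolding C0_semigroup_def by (metis atLeastAtMost_iff diff_ge_0_iff_ge)
      ultimately show ?thesis
        by (simp add: linear_simps)
    qed
    then have "norm (S t w - S s w) \<le> M * norm (S (t - s) w - w)"
      using M(2) that by simp
    also have "norm (S (t - s) w - w) < e / M"
      using d(2)[of "t - s"] that e M(1) S0 by (cases "s = t") auto
    finally show ?thesis
      using M(1) by (simp add: field_simps)
  qed
  show "\<exists>d>0. \<forall>x'\<in>{0..\<delta>}. dist x' x < d \<longrightarrow> dist (S x' w) (S x w) < e"
  proof (intro exI[of _ d] conjI ballI impI)
    fix y assume "y \<in> {0..\<delta>}" "dist y x < d"
    then show "dist (S y w) (S x w) < e"
      using close[of x y] close[of y x] x
      by (cases "x \<le> y") (auto simp: dist_norm norm_minus_commute)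
  qed (rule d)
qed

text \<open>The means \<open>F(h)/h\<close> with \<open>F(h) = \<integral>\<^sub>0\<^sup>h S(t) w dt\<close> tend to \<open>w\<close> as \<open>h \<rightarrow> 0\<close>, and they lie in the
  domain of the generator: applying \<open>S(r)\<close> shifts the interval of integration, so the difference
  quotient only sees the two ends of the interval.\<close>

lemma generator_domain_dense:
  fixes S :: "real \<Rightarrow> 'a::banach \<Rightarrow> 'a"
  assumes S: "C0_semigroup S" and e: "e > 0"
  obtains u v where "(u, v) \<in> generator S" "norm (u - w) < e"
proof -
  obtain \<delta> M where \<delta>: "\<delta> > 0" and M: "M > 0"
    "\<And>t w. 0 \<le> t \<Longrightarrow> t \<le> \<delta> \<Longrightarrow> norm (S t w) \<le> M * norm w"
    using C0_semigroup_locally_bounded[OF S] by blast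
  have S0: "S 0 w = w"
    using S unfolding C0_semigroup_def by auto
  define F where "F = (\<lambda>h. integral {0..h} (\<lambda>t. S t w))"
  have cont: "continuous_on {0..\<delta>} (\<lambda>t. S t w)"
    by (rule C0_semigroup_orbit_continuous[OF S M])
  have int: "(\<lambda>t. S t w) integrable_on {a..b}" if "0 \<le> a" "b \<le> \<delta>" for a b
    by (intro integrable_continuous_real continuous_on_subset[OF cont]) (use that in auto)
  have quot: "((\<lambda>r. (F (x + r) - F x) /\<^sub>R r) \<longlongrightarrow> S x w) (at_right 0)" if "0 \<le> x" "x < \<delta>" for x
  proof -
    have "(F has_vector_derivative S x w) (at x within {0..\<delta>})"
      unfolding F_def using that by (intro integral_has_vector_derivative[OF cont]) auto
    then have "(F has_vector_derivative S x w) (at x within {x..\<delta>})"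
      by (rule has_vector_derivative_within_subset) (use that in auto)
    then have "((\<lambda>y. (1 / \<bar>y - x\<bar>) *\<^sub>R (F y - (F x + (y - x) *\<^sub>R S x w))) \<longlongrightarrow> 0) (at_right x)"
      using that
      by (simp add: has_vector_derivative_def has_derivative_within at_within_Icc_at_right)
    then have "((\<lambda>r. (1 / \<bar>r\<bar>) *\<^sub>R (F (x + r) - (F x + r *\<^sub>R S x w))) \<longlongrightarrow> 0) (at_right 0)"
      by (subst (asm) filterlim_at_right_to_0) (simp add: add.commute)
    moreover have "\<forall>\<^sub>F r in at_right 0. (1 / \<bar>r\<bar>) *\<^sub>R (F (x + r) - (F x + r *\<^sub>R S x w)) =
        (F (x + r) - F x) /\<^sub>R r - S x w"
      by (rule eventually_mono[OF eventually_at_right_less])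
        (simp add: algebra_simps inverse_eq_divide)
    ultimately have "((\<lambda>r. (F (x + r) - F x) /\<^sub>R r - S x w) \<longlongrightarrow> 0) (at_right 0)"
      by (rule Lim_transform_eventually)
    then show ?thesis
      by (rule LIM_zero_cancel)
  qed
  have "((\<lambda>r. F r /\<^sub>R r) \<longlongrightarrow> w) (at_right 0)"
    using quot[of 0] \<delta> S0 by (simp add: F_def)
  then obtain d where d: "d > 0" "\<And>r. 0 < r \<Longrightarrow> r < d \<Longrightarrow> norm (F r /\<^sub>R r - w) < e"
    using e unfolding tendsto_iff eventually_at_right_field dist_norm by metis
  define h where "h = min d \<delta> / 2"
  have h: "0 < h" "h < d" "h < \<delta>"
    using d \<delta> by (auto simp: h_def)
  have shift: "S r (F h) = F (h + r) - F r" if r: "0 < r" "r < \<delta> - h" for r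
  proof -
    have "S r (F h) = integral {0..h} (S r \<circ> (\<lambda>t. S t w))"
      unfolding F_def using S h r int[of 0 h]
      by (subst integral_linear) (auto simp: C0_semigroup_def)
    also have "\<dots> = integral {0..h} ((\<lambda>t. S t w) \<circ> (+) r)"
      using S r by (intro integral_cong) (auto simp: C0_semigroup_def)
    also have "\<dots> = integral {r..h + r} (\<lambda>t. S t w)"
      by (subst integral_shift_Icc_real) simp
    also have "\<dots> = F (h + r) - F r"
      using Henstock_Kurzweil_Integration.integral_combine[of 0 r "h + r" "\<lambda>t. S t w"] int[of 0 "h + r"] h r
      by (simp add: F_def algebra_simps)
    finally show ?thesis .
  qed
  have "((\<lambda>r. (F (h + r) - F h) /\<^sub>R r - F r /\<^sub>R r) \<longlongrightarrow> S h w - w) (at_right 0)"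
    using quot[of h] quot[of 0] h S0 by (intro tendsto_diff) (auto simp: F_def)
  then have "((\<lambda>r. inverse h *\<^sub>R ((F (h + r) - F h) /\<^sub>R r - F r /\<^sub>R r)) \<longlongrightarrow> (S h w - w) /\<^sub>R h) (at_right 0)"
    by (intro tendsto_scaleR tendsto_const)
  moreover have "\<forall>\<^sub>F r in at_right 0. inverse h *\<^sub>R ((F (h + r) - F h) /\<^sub>R r - F r /\<^sub>R r) =
      (S r (F h /\<^sub>R h) - F h /\<^sub>R h) /\<^sub>R r"
  proof -
    have "inverse h *\<^sub>R ((F (h + r) - F h) /\<^sub>R r - F r /\<^sub>R r) =
      (S r (F h /\<^sub>R h) - F h /\<^sub>R h) /\<^sub>R r" if r: "0 < r" "r < \<delta> - h" for r
    proof -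
      have "bounded_linear (S r)"
        using S r unfolding C0_semigroup_def by auto
      then have eq: "S r (F h /\<^sub>R h) = (F (h + r) - F r) /\<^sub>R h"
        by (simp add: linear_simps shift[OF r])
      show ?thesis
        unfolding eq by (simp add: algebra_simps)
    qed
    then show ?thesis
      using h unfolding eventually_at_right_field by (intro exI[of _ "\<delta> - h"]) auto
  qed
  ultimately have "(F h /\<^sub>R h, (S h w - w) /\<^sub>R h) \<in> generator S"
    unfolding generator_def by (auto elim: Lim_transform_eventually)
  then show thesis
    using that d(2)[OF h(1,2)] by blast
qed

text \<open>The contraction half of the Lumer-Phillips theorem, for a semigroup whose existence is known.
  For \<open>u\<close> in the domain of the generator \<open>A\<close>, dissipativity gives
  \<open>\<parallel>S(s + h) u\<parallel> \<le> \<parallel>S(s + h) u - h A S(s + h) u\<parallel>\<close>, and the right-hand side is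
  \<open>\<parallel>S(s) u\<parallel>\<close> up to an error \<open>h \<parallel>S(s) \<rho>(h)\<parallel>\<close> with \<open>\<rho>(h) \<rightarrow> 0\<close>. Adding up \<open>n\<close> steps of length \<open>t/n\<close>
  leaves an error of order \<open>t \<parallel>\<rho>(t/n)\<parallel>\<close>. Density of the domain extends the bound to all vectors, and
  the semigroup law extends it beyond the interval on which local boundedness is known.\<close>

lemma dissipative_generator_imp_contraction:
  fixes S :: "real \<Rightarrow> 'a::banach \<Rightarrow> 'a"
  assumes S: "C0_semigroup S"
    and diss: "\<And>u v h. (u, v) \<in> generator S \<Longrightarrow> h > 0 \<Longrightarrow> norm u \<le> norm (u - h *\<^sub>R v)"
    and t: "t \<ge> 0"
  shows "norm (S t w) \<le> norm w"
proof -
  have lin: "bounded_linear (S r)" if "r \<ge> 0" for r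
    using S that unfolding C0_semigroup_def by blast
  have add: "S (r + s) w = S r (S s w)" if "r \<ge> 0" "s \<ge> 0" for r s w
    using S that unfolding C0_semigroup_def by blast
  have S0: "S 0 w = w" for w
    using S unfolding C0_semigroup_def by blast
  obtain \<delta> M where \<delta>: "\<delta> > 0" and M: "M > 0"
    "\<And>t w. 0 \<le> t \<Longrightarrow> t \<le> \<delta> \<Longrightarrow> norm (S t w) \<le> M * norm w"
    using C0_semigroup_locally_bounded[OF S] by blast

  have domain: "norm (S t u) \<le> norm u" if uv: "(u, v) \<in> generator S" and t: "0 < t" "t \<le> \<delta>" for u v t
  proof -
    define \<rho> where "\<rho> = (\<lambda>h. (S h u - u) /\<^sub>R h - S h v)"
    \<comment> \<open>The orbit stays in the domain, as \<open>S r\<close> is continuous and commutes with the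
      difference quotients.\<close>
    have inv: "(S r u, S r v) \<in> generator S" if "r \<ge> 0" for r
    proof -
      have "((\<lambda>h. S r ((S h u - u) /\<^sub>R h)) \<longlongrightarrow> S r v) (at_right 0)"
        using uv by (intro bounded_linear.tendsto[OF lin[OF that]]) (simp add: generator_def)
      moreover have "S r ((S h u - u) /\<^sub>R h) = (S h (S r u) - S r u) /\<^sub>R h" if "h > 0" for h
        using \<open>r \<ge> 0\<close> that add[of r h u] add[of h r u]
        by (simp add: linear_simps[OF lin] add.commute)
      then have "\<forall>\<^sub>F h in at_right 0. S r ((S h u - u) /\<^sub>R h) = (S h (S r u) - S r u) /\<^sub>R h"
        by (simp add: eventually_at_right_less eventually_mono[OF eventually_at_right_less])
      ultimately show ?thesis
        unfolding generator_def by (auto elim: Lim_transform_eventually)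
    qed
    have step: "norm (S (s + h) u) \<le> norm (S s u) + h * (M * norm (\<rho> h))"
      if "0 \<le> s" "s \<le> \<delta>" "0 < h" for s h
    proof -
      have "norm (S (s + h) u) \<le> norm (S (s + h) u - h *\<^sub>R S (s + h) v)"
        using diss inv that by auto
      also have "S (s + h) u - h *\<^sub>R S (s + h) v = S s u + h *\<^sub>R S s (\<rho> h)"
        using that
        by (simp only: \<rho>_def add less_imp_le) (simp add: linear_simps[OF lin] algebra_simps)
      also have "norm \<dots> \<le> norm (S s u) + h * (M * norm (\<rho> h))"
        using M(2)[of s "\<rho> h"] that by (intro norm_triangle_le add_left_mono) (simp add: mult_left_mono)
      finally show ?thesis .
    qed
    have bound: "norm (S t u) \<le> norm u + t * M * norm (\<rho> (t / real (Suc n)))" for n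
    proof -
      define h where "h = t / real (Suc n)"
      have h: "h > 0" "real (Suc n) * h = t"
        using t by (simp_all add: h_def)
      have "norm (S (real k * h) u) \<le> norm u + real k * (h * (M * norm (\<rho> h)))" if "k \<le> Suc n" for k
        using that
      proof (induction k)
        case (Suc k)
        have "real k * h \<le> real (Suc n) * h"
          using Suc.prems h by (intro mult_right_mono) auto
        then show ?case
          using step[of "real k * h" h] Suc h t by (simp add: algebra_simps)
      qed (simp add: S0)
      from this[of "Suc n"] show ?thesis
        by (simp only: h h_def[symmetric] mult.assoc[symmetric] order_refl)
    qed
    have "((\<lambda>h. S h v) \<longlongrightarrow> v) (at_right 0)"
      using S unfolding C0_semigroup_def by auto
    then have \<rho>0: "(\<rho> \<longlongrightarrow> v - v) (at_right 0)"
      unfolding \<rho>_def using uv by (intro tendsto_diff) (auto simp: generator_def)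
    have h0: "filterlim (\<lambda>n. t / real (Suc n)) (at_right 0) sequentially"
    proof (rule filterlim_at_withinI)
      show "(\<lambda>n. t / real (Suc n)) \<longlonglongrightarrow> 0"
        using tendsto_mult_right_zero[OF LIMSEQ_inverse_real_of_nat, of t] by (simp add: divide_inverse)
    qed (use t in \<open>auto intro!: always_eventually\<close>)
    have "(\<lambda>n. norm u + t * M * norm (\<rho> (t / real (Suc n)))) \<longlonglongrightarrow> norm u + t * M * norm (v - v)"
      by (intro tendsto_intros filterlim_compose[OF \<rho>0 h0])
    then have "norm (S t u) \<le> norm u + t * M * norm (v - v)"
      by (rule LIMSEQ_le_const) (use bound in auto)
    then show ?thesis by simp
  qed

  have short: "norm (S t w) \<le> norm w" if t: "0 < t" "t \<le> \<delta>" for t w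
  proof (rule field_le_epsilon)
    fix e :: real assume e: "e > 0"
    obtain u v where uv: "(u, v) \<in> generator S" "norm (u - w) < e / (M + 1)"
      using generator_domain_dense[OF S, of "e / (M + 1)" w] e M(1) by auto
    have "norm (S t w) = norm (S t u - S t (u - w))"
      using t by (simp add: linear_simps[OF lin])
    also have "\<dots> \<le> norm (S t u) + norm (S t (u - w))"
      by (rule norm_triangle_ineq4)
    also have "\<dots> \<le> norm u + M * norm (u - w)"
      using domain[OF uv(1) t] M(2)[of t "u - w"] t by auto
    also have "\<dots> \<le> norm w + (M + 1) * norm (u - w)"
      using norm_triangle_sub[of u w] by (simp add: algebra_simps)
    also have "\<dots> \<le> norm w + e"
      using uv(2) M(1) by (simp add: field_simps)
    finally show "norm (S t w) \<le> norm w + e" .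
  qed

  show ?thesis
  proof (cases "t = 0")
    case False
    obtain n :: nat where n: "t / \<delta> \<le> real n"
      using real_arch_simple by blast
    define h where "h = t / real (Suc n)"
    have h: "0 < h" "h \<le> \<delta>" "real (Suc n) * h = t"
      using n t False \<delta> by (auto simp: h_def field_simps intro: order_trans)
    have "norm (S (real k * h) w) \<le> norm w" for k
    proof (induction k)
      case (Suc k)
      have "S (real (Suc k) * h) w = S h (S (real k * h) w)"
        using add[of h "real k * h" w] h by (simp add: algebra_simps)
      then show ?case
        using short[OF h(1,2), of "S (real k * h) w"] Suc by simp
    qed (simp add: S0)
    from this[of "Suc n"] show ?thesis
      by (simp only: h)
  qed (simp add: S0)
qed

section \<open>The maximum principle for the periodic heat semigroup\<close>

lemma second_derivative_at_maximum:
  fixes f f' :: "real \<Rightarrow> real"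
  assumes f: "\<And>s. (f has_real_derivative f' s) (at s)"
    and f': "(f' has_real_derivative c) (at 0)"
    and max: "\<And>s. f s \<le> f 0"
  shows "c \<le> 0"
proof (rule ccontr)
  assume "\<not> c \<le> 0"
  have zero: "f' 0 = 0"
    using DERIV_local_max[OF f, of 1 0] max by auto
  obtain d where d: "d > 0" "\<And>h. 0 < h \<Longrightarrow> h < d \<Longrightarrow> f' 0 < f' h"
    using DERIV_pos_inc_right[OF f'] \<open>\<not> c \<le> 0\<close> by auto
  obtain z where "0 < z" "z < d / 2" "f (d / 2) - f 0 = (d / 2 - 0) * f' z"
    using MVT2[of 0 "d / 2" f f'] f d(1) by auto
  moreover have "f' z > 0"
    using d calculation zero by auto
  ultimately show False
    using max[of "d / 2"] d(1) by (smt (verit) half_gt_zero mult_pos_pos)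
qed

lemma has_partial_along_axis:
  assumes "has_partial W i V"
  shows "((\<lambda>h. field_at W (x + h *\<^sub>R axis i 1)) has_vector_derivative
    field_at V (x + s *\<^sub>R axis i 1)) (at s)"
proof -
  let ?g = "\<lambda>h. field_at W ((x + s *\<^sub>R axis i 1) + h *\<^sub>R axis i 1)"
  have "(?g \<circ> (\<lambda>h. h - s) has_vector_derivative 1 *\<^sub>R field_at V (x + s *\<^sub>R axis i 1)) (at s)"
    using assms unfolding has_partial_def
    by (intro vector_diff_chain_at) (auto intro!: derivative_eq_intros)
  moreover have "?g \<circ> (\<lambda>h. h - s) = (\<lambda>h. field_at W (x + h *\<^sub>R axis i 1))"
    by (auto simp: fun_eq_iff algebra_simps)
  ultimately show ?thesis
    by simp
qed

text \<open>On the line through \<open>x0\<close> along the axis \<open>i\<close>, half the second derivative of \<open>|W|\<^sup>2\<close> is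
  \<open>W \<bullet> \<partial>\<^sub>i\<partial>\<^sub>iW + |\<partial>\<^sub>iW|\<^sup>2\<close>. It is not positive at a maximum, and the second summand is nonnegative.
  Passing through \<open>|W|\<^sup>2\<close> is what makes the scalar maximum principle work for matrix fields in the
  Frobenius norm.\<close>

lemma laplacian_inner_nonpos_at_maximum:
  assumes D: "has_partial W i D" and H: "has_partial D i H"
    and max: "\<And>x. norm (field_at W x) \<le> norm (field_at W x0)"
  shows "field_at W x0 \<bullet> field_at H x0 \<le> 0"
proof -
  let ?p = "\<lambda>s. x0 + s *\<^sub>R axis i (1::real)"
  define f where "f = (\<lambda>s. field_at W (?p s) \<bullet> field_at W (?p s))"
  define f' where "f' = (\<lambda>s. 2 * (field_at W (?p s) \<bullet> field_at D (?p s)))"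
  note W' = has_partial_along_axis[OF D, unfolded has_vector_derivative_def]
  note D' = has_partial_along_axis[OF H, unfolded has_vector_derivative_def]
  have "(f has_real_derivative f' s) (at s)" for s
    unfolding f_def f'_def has_field_derivative_def
    by (rule derivative_eq_intros W' refl)+ (auto simp: inner_commute fun_eq_iff)
  moreover have "(f' has_real_derivative
      2 * (field_at W x0 \<bullet> field_at H x0 + field_at D x0 \<bullet> field_at D x0)) (at 0)"
    unfolding f'_def has_field_derivative_def
    by (rule derivative_eq_intros W' D' refl)+ (auto simp: fun_eq_iff algebra_simps)
  moreover have "f s \<le> f 0" for s
    using max[of "?p s"] by (simp add: f_def flip: power2_norm_eq_inner)
  ultimately have "2 * (field_at W x0 \<bullet> field_at H x0 + field_at D x0 \<bullet> field_at D x0) \<le> 0"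
    by (rule second_derivative_at_maximum)
  then show ?thesis
    using inner_ge_zero[of "field_at D x0"] by (smt (verit))
qed

lemma field_norm_attained:
  obtains x0 where "norm W = norm (field_at W x0)" "\<And>x. norm (field_at W x) \<le> norm (field_at W x0)"
proof -
  have "\<exists>x0\<in>Omega. \<forall>y\<in>Omega. norm (field_at W y) \<le> norm (field_at W x0)"
    by (intro continuous_attains_sup continuous_on_norm continuous_on_field_at Omega_nonempty)
      (simp add: Omega_def)
  then obtain x0 where x0: "\<And>y. y \<in> Omega \<Longrightarrow> norm (field_at W y) \<le> norm (field_at W x0)"
    by blast
  then have "norm W \<le> norm (field_at W x0)"
    by (rule norm_pfield_leI)
  then show thesis
    using norm_field_at_le[of W] that by (metis order_antisym)
qed

lemma field_at_sum: "field_at (\<Sum>i\<in>A. H i) x = (\<Sum>i\<in>A. field_at (H i) x)"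
  by (induction A rule: infinite_finite_induct) (simp_all add: zero_pfield.rep_eq plus_pfield.rep_eq)

text \<open>At a point where the norm of \<open>W\<close> is attained, \<open>V\<close> has nonpositive inner product with \<open>W\<close>,
  so subtracting \<open>h V\<close> cannot shorten \<open>W\<close> there.\<close>

lemma diffusion_dissipative:
  assumes "(W, V) \<in> diffusion_graph \<epsilon>" and h: "h > 0"
  shows "norm W \<le> norm (W - h *\<^sub>R V)"
proof -
  obtain D H where V: "V = \<epsilon>\<^sup>2 *\<^sub>R (\<Sum>i\<in>UNIV. H i i)"
    and D: "\<And>i. has_partial W i (D i)" and H: "\<And>i j. has_partial (D i) j (H i j)"
    using assms(1) unfolding diffusion_graph_def by auto
  obtain x0 where x0: "norm W = norm (field_at W x0)"
    "\<And>x. norm (field_at W x) \<le> norm (field_at W x0)"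
    using field_norm_attained[of W] by blast
  let ?w = "field_at W x0" and ?v = "field_at V x0"
  have "?w \<bullet> ?v = \<epsilon>\<^sup>2 * (\<Sum>i\<in>UNIV. ?w \<bullet> field_at (H i i) x0)"
    by (simp add: V scaleR_pfield.rep_eq field_at_sum inner_sum_right)
  also have "\<dots> \<le> 0"
    using laplacian_inner_nonpos_at_maximum[OF D H x0(2)]
    by (intro mult_nonneg_nonpos sum_nonpos) auto
  finally have "?w \<bullet> ?v \<le> 0" .
  then have "h * (?w \<bullet> ?v) \<le> 0"
    using h by (simp add: mult_nonneg_nonpos)
  have "(norm (?w - h *\<^sub>R ?v))\<^sup>2 = (norm ?w)\<^sup>2 - 2 * (h * (?w \<bullet> ?v)) + (norm (h *\<^sub>R ?v))\<^sup>2"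
    unfolding power2_norm_eq_inner
    by (simp add: inner_diff_left inner_diff_right inner_commute)
  then have "(norm ?w)\<^sup>2 \<le> (norm (?w - h *\<^sub>R ?v))\<^sup>2"
    using \<open>h * (?w \<bullet> ?v) \<le> 0\<close> zero_le_power2[of "norm (h *\<^sub>R ?v)"] by linarith
  then have "norm ?w \<le> norm (?w - h *\<^sub>R ?v)"
    by (rule power2_le_imp_le) simp
  then have "norm W \<le> norm (field_at (W - h *\<^sub>R V) x0)"
    by (simp add: x0(1) minus_pfield.rep_eq scaleR_pfield.rep_eq)
  then show ?thesis
    using norm_field_at_le order_trans by blast
qed

text \<open>Dissipativity is a closed condition on pairs, so it passes from the classical Laplacian to its
  closure, the generator.\<close>

lemma heat_semigroup_contraction:
  fixes S :: "real \<Rightarrow> 'm::finite pfield \<Rightarrow> 'm pfield"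
  assumes "periodic_heat_semigroup \<epsilon> S" and "t \<ge> 0"
  shows "norm (S t W) \<le> norm W"
proof (rule dissipative_generator_imp_contraction)
  show "C0_semigroup S" "t \<ge> 0"
    using assms unfolding periodic_heat_semigroup_def by auto
  fix u v and h :: real assume uv: "(u, v) \<in> generator S" and h: "h > 0"
  have "closed {p :: 'm pfield \<times> 'm pfield. norm (fst p) \<le> norm (fst p - h *\<^sub>R snd p)}"
    by (intro closed_Collect_le continuous_intros)
  then have "closure (diffusion_graph \<epsilon> :: ('m pfield \<times> 'm pfield) set)
    \<subseteq> {p. norm (fst p) \<le> norm (fst p - h *\<^sub>R snd p)}"
    using h by (intro closure_minimal) (auto intro: diffusion_dissipative)
  then show "norm u \<le> norm (u - h *\<^sub>R v)"
    using uv assms(1) unfolding periodic_heat_semigroup_def by auto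
qed

section \<open>The ETDRK2 scheme\<close>

text \<open>The weights \<open>exp(-\<kappa>\<tau>)\<close> of the initial value and \<open>\<integral>\<^sub>0\<^sup>\<tau> \<kappa> exp(-\<kappa>(\<tau> - s)) ds\<close> of the source add up to
  \<open>1\<close>, so the step is a kind of average; this is why the time step is unrestricted.\<close>

lemma etd_step_norm_le:
  assumes S: "\<And>t W. t \<ge> 0 \<Longrightarrow> norm (S t W) \<le> norm W"
    and \<kappa>: "\<kappa> > 0" and \<tau>: "\<tau> > 0" and U: "norm U \<le> r"
    and F: "\<And>s. 0 \<le> s \<Longrightarrow> s \<le> \<tau> \<Longrightarrow> norm (F s) \<le> \<kappa> * r"
  shows "norm (etd_propagator S \<kappa> \<tau> U +
    integral {0..\<tau>} (\<lambda>s. etd_propagator S \<kappa> (\<tau> - s) (F s))) \<le> r"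
proof -
  let ?I = "integral {0..\<tau>} (\<lambda>s. etd_propagator S \<kappa> (\<tau> - s) (F s))"
  have propagator: "norm (etd_propagator S \<kappa> t W) \<le> exp (- \<kappa> * t) * b" if "t \<ge> 0" "norm W \<le> b" for t W b
    using order_trans[OF S[OF that(1)] that(2)] by (simp add: etd_propagator_def)
  have "0 \<le> r"
    using U norm_ge_zero order_trans by blast
  have weight: "((\<lambda>s. exp (- \<kappa> * (\<tau> - s)) * (\<kappa> * r)) has_integral
      exp (- \<kappa> * (\<tau> - \<tau>)) * r - exp (- \<kappa> * (\<tau> - 0)) * r) {0..\<tau>}"
    using \<tau>
    by (intro fundamental_theorem_of_calculus)
      (auto intro!: derivative_eq_intros simp flip: has_real_derivative_iff_has_vector_derivative)
  have "norm ?I \<le> (1 - exp (- \<kappa> * \<tau>)) * r"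
  proof (cases "(\<lambda>s. etd_propagator S \<kappa> (\<tau> - s) (F s)) integrable_on {0..\<tau>}")
    case True
    then have "norm ?I \<le> integral {0..\<tau>} (\<lambda>s. exp (- \<kappa> * (\<tau> - s)) * (\<kappa> * r))"
      using weight F
      by (intro Henstock_Kurzweil_Integration.integral_norm_bound_integral propagator) auto
    then show ?thesis
      using integral_unique[OF weight] by (simp add: algebra_simps)
  next
    \<comment> \<open>A non-integrable integrand has integral \<open>0\<close> by convention.\<close>
    case False
    then show ?thesis
      using \<kappa> \<tau> \<open>0 \<le> r\<close> by (simp add: not_integrable_integral)
  qed
  then show ?thesis
    using norm_triangle_ineq[of "etd_propagator S \<kappa> \<tau> U" ?I] propagator[of \<tau> U r] \<tau> U
    by (simp add: algebra_simps)
qed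

lemma norm_nonlinearity_le:
  fixes U :: "'m::finite pfield"
  assumes U: "norm U \<le> sqrt (real CARD('m))"
    and \<kappa>: "\<kappa> \<ge> 2" "real CARD('m) \<le> 2 * \<kappa>"
  shows "norm (nonlinearity \<kappa> U) \<le> \<kappa> * sqrt (real CARD('m))"
  using norm_shifted_reaction_le[OF order_trans[OF norm_field_at_le U] \<kappa>]
  by (intro norm_pfield_leI) (simp add: nonlinearity.rep_eq)

lemma etdrk2_step_norm_le:
  fixes S :: "real \<Rightarrow> 'm::finite pfield \<Rightarrow> 'm pfield"
  assumes S: "\<And>t W. t \<ge> 0 \<Longrightarrow> norm (S t W) \<le> norm W"
    and \<kappa>: "\<kappa> \<ge> 2" "real CARD('m) \<le> 2 * \<kappa>" and \<tau>: "\<tau> > 0"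
    and U: "norm U \<le> sqrt (real CARD('m))"
  shows "norm (etdrk2_step S \<kappa> \<tau> U) \<le> sqrt (real CARD('m))"
proof -
  note N = norm_nonlinearity_le[OF _ \<kappa>]
  let ?V = "etdrk2_predictor S \<kappa> \<tau> U"
  have V: "norm ?V \<le> sqrt (real CARD('m))"
    unfolding etdrk2_predictor_def using \<kappa>(1)
    by (intro etd_step_norm_le S \<tau> U N) auto
  show ?thesis
    unfolding etdrk2_step_def
  proof (intro etd_step_norm_le S \<tau> U)
    fix s assume s: "0 \<le> s" "s \<le> \<tau>"
    have "norm ((1 - s / \<tau>) *\<^sub>R nonlinearity \<kappa> U + (s / \<tau>) *\<^sub>R nonlinearity \<kappa> ?V)
      \<le> (1 - s / \<tau>) * norm (nonlinearity \<kappa> U) + (s / \<tau>) * norm (nonlinearity \<kappa> ?V)"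
      using s \<tau> by (intro norm_triangle_le) simp
    also have "\<dots> \<le> \<kappa> * sqrt (real CARD('m))"
      using s \<tau> N[OF U] N[OF V] by (intro convex_bound_le) auto
    finally show "norm ((1 - s / \<tau>) *\<^sub>R nonlinearity \<kappa> U + (s / \<tau>) *\<^sub>R nonlinearity \<kappa> ?V)
      \<le> \<kappa> * sqrt (real CARD('m))" .
  qed (use \<kappa> in auto)
qed

theorem theorem3p2:
  fixes S :: "real \<Rightarrow> 'm::finite pfield \<Rightarrow> 'm pfield"
    and U0 :: "'m pfield"
    and \<epsilon> \<kappa> :: real
  assumes "CARD('m) \<ge> 2"
    and "\<epsilon> > 0"
    and "periodic_heat_semigroup \<epsilon> S"
    and "\<forall>x\<in>Omega. norm (field_at U0 x) \<le> sqrt (real CARD('m))"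
    and "\<kappa> \<ge> max (3 / 2 * real CARD('m) - 1) 2"
  shows "\<forall>\<tau>>0. \<forall>n\<ge>1. \<forall>x\<in>Omega. norm (field_at (etdrk2 S \<kappa> \<tau> U0 n) x) \<le> sqrt (real CARD('m))"
proof (intro allI impI ballI)
  fix \<tau> :: real and n :: nat and x :: "real ^ 'm"
  assume \<tau>: "\<tau> > 0"
  have \<kappa>: "\<kappa> \<ge> 2" "real CARD('m) \<le> 2 * \<kappa>"
    using assms(5) by auto
  have "norm (etdrk2 S \<kappa> \<tau> U0 n) \<le> sqrt (real CARD('m))"
  proof (induction n)
    case 0
    show ?case
      using assms(4) by (simp add: norm_pfield_leI)
  next
    case (Suc n)
    then show ?case
      using etdrk2_step_norm_le[OF heat_semigroup_contraction[OF assms(3)] \<kappa> \<tau>] by simp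
  qed
  then show "norm (field_at (etdrk2 S \<kappa> \<tau> U0 n) x) \<le> sqrt (real CARD('m))"
    using norm_field_at_le order_trans by blast
qed

end
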